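(* Let $E$ be an $n$-dimensional complex evolution algebra with natural basis $\{e_1,\dots,e_n\}$ whose matrix $A=(a_{ij})_{1\le i,j\le n}$ in this basis is non-singular. If $d:E\to E$ is a derivation of $E$, then $d=0$.
   Context: An $n$-dimensional complex evolution algebra is a complex vector space $E$ of dimension $n$ with a bilinear product $\cdot$ and a basis $\{e_1,\dots,e_n\}$ (called a natural basis) such that $e_i\cdot e_j=0$ for $i\neq j$ and $e_i\cdot e_i=\sum_{j=1}^n a_{ij}e_j$ for $1\le i\le n$. The matrix $A=(a_{ij})$ is called the matrix of $E$ in the natural basis. A derivation of $E$ is a linear map $d:E\to E$ with $d(u\cdot v)=d(u)\cdot v+u\cdot d(v)$ for all $u,v\in E$. *)

theory Defs
  imports "HOL-Analysis.Analysis"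
begin

locale complex_algebra = vector_space scale
  for scale :: "complex \<Rightarrow> 'e::ab_group_add \<Rightarrow> 'e" +
  fixes mult :: "'e \<Rightarrow> 'e \<Rightarrow> 'e"
  assumes linear_mult_left: "Vector_Spaces.linear scale scale (\<lambda>u. mult u v)"
    and linear_mult_right: "Vector_Spaces.linear scale scale (\<lambda>v. mult u v)"

(* The product is not assumed associative or unital. The natural basis is indexed by a finite
   type, so the dimension n is CARD('n); A $ i $ j is the coefficient a_ij of e_j in the square
   of e_i, that is, row i of A holds the coordinates of that square. *)
locale evolution_algebra = complex_algebra scale mult
  for scale :: "complex \<Rightarrow> 'e::ab_group_add \<Rightarrow> 'e"
    and mult :: "'e \<Rightarrow> 'e \<Rightarrow> 'e" +
  fixes e :: "'n::finite \<Rightarrow> 'e"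
    and A :: "complex ^ 'n ^ 'n"
  assumes basis_inj: "inj e"
    and basis_independent: "independent (range e)"
    and basis_span: "span (range e) = UNIV"
    and mult_basis_distinct: "i \<noteq> j \<Longrightarrow> mult (e i) (e j) = 0"
    and mult_basis_square: "mult (e i) (e i) = (\<Sum>j\<in>UNIV. scale (A $ i $ j) (e j))"

definition (in complex_algebra) derivation :: "('e \<Rightarrow> 'e) \<Rightarrow> bool" where
  "derivation d \<longleftrightarrow> Vector_Spaces.linear scale scale d \<and>
     (\<forall>u v. d (mult u v) = mult (d u) v + mult u (d v))"

end

theory Submission
  imports Defs
begin

text \<open>
  Non-singularity of \<open>A\<close> says that the squares \<open>e\<^sub>i \<cdot> e\<^sub>i\<close> are linearly independent. Let \<open>d\<close> be a
  derivation and write \<open>d e\<^sub>i = \<Sum>\<^sub>j D\<^sub>i\<^sub>j e\<^sub>j\<close>. Applying \<open>d\<close> to \<open>e\<^sub>i \<cdot> e\<^sub>j = 0\<close> with \<open>i \<noteq> j\<close> gives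
  \<open>D\<^sub>i\<^sub>j (e\<^sub>j \<cdot> e\<^sub>j) + D\<^sub>j\<^sub>i (e\<^sub>i \<cdot> e\<^sub>i) = 0\<close>, so \<open>D\<close> is diagonal: every \<open>e\<^sub>i\<close> is an eigenvector of
  \<open>d\<close>, with eigenvalue \<open>l\<^sub>i\<close>, say.

  The Leibniz rule then makes \<open>e\<^sub>i \<cdot> e\<^sub>i\<close> an eigenvector with eigenvalue \<open>2 l\<^sub>i\<close>, so \<open>l\<^sub>j = 2 l\<^sub>i\<close>
  whenever \<open>e\<^sub>j\<close> occurs in \<open>e\<^sub>i \<cdot> e\<^sub>i\<close>; and some \<open>e\<^sub>j\<close> does, because \<open>A\<close> has no zero row. Hence
  doubling maps the finite set of eigenvalues into itself. An eigenvalue of largest modulus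
  must then vanish, and with it all the others.
\<close>

lemma invertible_row_nonzero:
  fixes A :: "'a::semiring_1 ^ 'n ^ 'n"
  assumes "invertible A"
  shows "\<exists>j. A $ i $ j \<noteq> 0"
proof (rule ccontr)
  assume "\<not> ?thesis"
  then have zero: "A $ i $ j = 0" for j by simp
  obtain B where "A ** B = mat 1"
    using assms by (auto simp: invertible_def)
  then have "(A ** B) $ i $ i = 1"
    by (simp add: mat_def)
  then show False
    by (simp add: matrix_matrix_mult_def zero)
qed

lemma invertible_rows_pair_independent:
  fixes A :: "'a::comm_ring_1 ^ 'n ^ 'n"
  assumes "invertible A" and "i \<noteq> j"
    and relation: "\<And>k. x * A $ i $ k + y * A $ j $ k = 0"
  shows "x = 0"
proof -
  obtain B where B: "A ** B = mat 1"
    using assms(1) by (auto simp: invertible_def)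
  \<comment> \<open>Contracting the relation with column \<open>i\<close> of the inverse isolates the coefficient \<open>x\<close>.\<close>
  have "x = x * (A ** B) $ i $ i + y * (A ** B) $ j $ i"
    using \<open>i \<noteq> j\<close> by (simp add: B mat_def)
  also have "\<dots> = (\<Sum>k\<in>UNIV. (x * A $ i $ k + y * A $ j $ k) * B $ k $ i)"
    by (simp add: matrix_matrix_mult_def sum_distrib_left sum.distrib distrib_right mult.assoc)
  also have "\<dots> = 0"
    by (simp add: relation)
  finally show ?thesis .
qed

lemma doubling_invariant_eq_zero:
  fixes l :: "'n::finite \<Rightarrow> 'a::real_normed_vector"
  assumes "\<And>i. \<exists>j. l j = 2 *\<^sub>R l i"
  shows "l i = 0"
proof -
  have "Max (range (\<lambda>k. norm (l k))) \<in> range (\<lambda>k. norm (l k))"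
    by (intro Max_in) auto
  then obtain m where m: "Max (range (\<lambda>k. norm (l k))) = norm (l m)"
    by (rule rangeE)
  have max: "norm (l k) \<le> norm (l m)" for k
    unfolding m[symmetric] by (intro Max_ge) auto
  obtain j where "l j = 2 *\<^sub>R l m"
    using assms by blast
  then have "norm (l m) = 0"
    using max[of j] by simp
  then show ?thesis
    using max[of i] by simp
qed

context evolution_algebra
begin

lemma basis_expansion: "\<exists>c. u = (\<Sum>j\<in>UNIV. scale (c j) (e j))"
proof -
  have "u \<in> span (range e)"
    using basis_span by simp
  then obtain c where "u = (\<Sum>v\<in>range e. scale (c v) v)"
    by (auto simp: span_finite)
  then have "u = (\<Sum>j\<in>UNIV. scale (c (e j)) (e j))"
    using basis_inj by (simp add: sum.reindex)
  then show ?thesis by (rule exI[of _ "\<lambda>j. c (e j)"])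
qed

lemma basis_coefficients_zero:
  assumes "(\<Sum>j\<in>UNIV. scale (c j) (e j)) = 0"
  shows "c k = 0"
proof -
  have "(\<Sum>v\<in>range e. scale (c (inv e v)) v) = 0"
    using assms basis_inj by (simp add: sum.reindex)
  then have "c (inv e (e k)) = 0"
    using independentD[OF basis_independent, of "range e" "\<lambda>v. c (inv e v)" "e k"] by auto
  then show ?thesis
    using basis_inj by simp
qed

lemma basis_coefficients_unique:
  assumes "(\<Sum>j\<in>UNIV. scale (b j) (e j)) = (\<Sum>j\<in>UNIV. scale (c j) (e j))"
  shows "b k = c k"
  using assms basis_coefficients_zero[of "\<lambda>j. b j - c j" k]
  by (simp add: scale_left_diff_distrib sum_subtractf)

lemma mult_expansion_basis:
  "mult (\<Sum>j\<in>UNIV. scale (c j) (e j)) (e k) = scale (c k) (mult (e k) (e k))"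
proof -
  interpret L: Vector_Spaces.linear scale scale "\<lambda>u. mult u (e k)"
    by (rule linear_mult_left)
  have "mult (\<Sum>j\<in>UNIV. scale (c j) (e j)) (e k) = (\<Sum>j\<in>UNIV. scale (c j) (mult (e j) (e k)))"
    by (simp add: L.sum L.scale)
  also have "\<dots> = (\<Sum>j\<in>UNIV. if j = k then scale (c k) (mult (e k) (e k)) else 0)"
    by (intro sum.cong) (auto simp: mult_basis_distinct)
  finally show ?thesis by simp
qed

lemma mult_basis_expansion:
  "mult (e k) (\<Sum>j\<in>UNIV. scale (c j) (e j)) = scale (c k) (mult (e k) (e k))"
proof -
  interpret R: Vector_Spaces.linear scale scale "\<lambda>v. mult (e k) v"
    by (rule linear_mult_right)
  have "mult (e k) (\<Sum>j\<in>UNIV. scale (c j) (e j)) = (\<Sum>j\<in>UNIV. scale (c j) (mult (e k) (e j)))"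
    by (simp add: R.sum R.scale)
  also have "\<dots> = (\<Sum>j\<in>UNIV. if j = k then scale (c k) (mult (e k) (e k)) else 0)"
    by (intro sum.cong) (auto simp: mult_basis_distinct)
  finally show ?thesis by simp
qed

text \<open>
  Off the diagonal, the Leibniz rule applied to \<open>e\<^sub>i \<cdot> e\<^sub>j = 0\<close> is a linear relation between two
  distinct squares of basis vectors, that is, between two rows of \<open>A\<close>.
\<close>

lemma derivation_diagonal:
  assumes "invertible A" and "derivation d"
  shows "\<exists>l. \<forall>i. d (e i) = scale (l i) (e i)"
proof -
  interpret d: Vector_Spaces.linear scale scale d
    using assms(2) by (simp add: derivation_def)
  have leibniz: "d (mult u v) = mult (d u) v + mult u (d v)" for u v
    using assms(2) by (simp add: derivation_def)
  have "\<forall>i. \<exists>c. d (e i) = (\<Sum>j\<in>UNIV. scale (c j) (e j))"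
    by (intro allI basis_expansion)
  then have "\<exists>D. \<forall>i. d (e i) = (\<Sum>j\<in>UNIV. scale (D i j) (e j))"
    by (rule choice)
  then obtain D where D: "\<And>i. d (e i) = (\<Sum>j\<in>UNIV. scale (D i j) (e j))"
    by blast
  have off_diagonal: "D i j = 0" if "i \<noteq> j" for i j
  proof (rule invertible_rows_pair_independent[OF assms(1)])
    show "j \<noteq> i" using that by simp
    have "scale (D i j) (mult (e j) (e j)) + scale (D j i) (mult (e i) (e i))
        = mult (d (e i)) (e j) + mult (e i) (d (e j))"
      by (simp add: D mult_expansion_basis mult_basis_expansion)
    also have "\<dots> = 0"
      using leibniz[of "e i" "e j"] that by (simp add: mult_basis_distinct d.zero)
    finally have "(\<Sum>k\<in>UNIV. scale (D i j * A $ j $ k + D j i * A $ i $ k) (e k)) = 0"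
      by (simp add: mult_basis_square scale_sum_right scale_left_distrib sum.distrib)
    then show "D i j * A $ j $ k + D j i * A $ i $ k = 0" for k
      by (rule basis_coefficients_zero)
  qed
  have "d (e i) = scale (D i i) (e i)" for i
  proof -
    have "d (e i) = (\<Sum>j\<in>UNIV. if j = i then scale (D i i) (e i) else 0)"
      unfolding D by (intro sum.cong) (auto simp: off_diagonal)
    then show ?thesis by simp
  qed
  then show ?thesis by (intro exI[of _ "\<lambda>i. D i i"]) simp
qed

text \<open>
  The square of a basis vector with eigenvalue \<open>l i\<close> has eigenvalue \<open>2 * l i\<close> by the Leibniz
  rule. Since eigenvectors can be compared coordinatewise, every basis vector occurring in the
  square has this eigenvalue too.
\<close>

lemma derivation_eigenvalue_doubles:
  assumes "derivation d"
    and eigen: "\<And>i. d (e i) = scale (l i) (e i)"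
    and "A $ i $ j \<noteq> 0"
  shows "l j = 2 * l i"
proof -
  interpret d: Vector_Spaces.linear scale scale d
    using assms(1) by (simp add: derivation_def)
  interpret L: Vector_Spaces.linear scale scale "\<lambda>u. mult u (e i)"
    by (rule linear_mult_left)
  interpret R: Vector_Spaces.linear scale scale "\<lambda>v. mult (e i) v"
    by (rule linear_mult_right)
  have "(\<Sum>k\<in>UNIV. scale (A $ i $ k * l k) (e k)) = d (mult (e i) (e i))"
    by (simp add: mult_basis_square d.sum d.scale eigen)
  also have "\<dots> = mult (d (e i)) (e i) + mult (e i) (d (e i))"
    using assms(1) by (simp add: derivation_def)
  also have "\<dots> = scale (2 * l i) (mult (e i) (e i))"
    by (simp only: eigen L.scale R.scale mult_2 scale_left_distrib)
  also have "\<dots> = (\<Sum>k\<in>UNIV. scale (2 * l i * A $ i $ k) (e k))"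
    by (simp add: mult_basis_square scale_sum_right)
  finally have "A $ i $ j * l j = 2 * l i * A $ i $ j"
    by (rule basis_coefficients_unique)
  then show ?thesis
    using assms(3) by (simp add: mult.commute)
qed

lemma derivation_eq_zero:
  assumes "invertible A" and "derivation d"
  shows "d = (\<lambda>u. 0)"
proof
  fix u
  interpret d: Vector_Spaces.linear scale scale d
    using assms(2) by (simp add: derivation_def)
  obtain l where l: "\<And>i. d (e i) = scale (l i) (e i)"
    using derivation_diagonal[OF assms] by blast
  have "\<exists>j. l j = 2 *\<^sub>R l i" for i
    using invertible_row_nonzero[OF assms(1), of i]
      derivation_eigenvalue_doubles[OF assms(2) l]
    by (auto simp: scaleR_conv_of_real)
  then have "l i = 0" for i
    by (rule doubling_invariant_eq_zero)
  then have vanish: "d (e i) = 0" for i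
    by (simp add: l)
  obtain c where "u = (\<Sum>j\<in>UNIV. scale (c j) (e j))"
    using basis_expansion[of u] by blast
  then show "d u = 0"
    by (simp add: d.sum d.scale vanish)
qed

end

theorem theorem2p1:
  fixes scale :: "complex \<Rightarrow> 'e::ab_group_add \<Rightarrow> 'e"
    and mult :: "'e \<Rightarrow> 'e \<Rightarrow> 'e"
    and e :: "'n::finite \<Rightarrow> 'e"
    and A :: "complex ^ 'n ^ 'n"
    and d :: "'e \<Rightarrow> 'e"
  assumes "evolution_algebra scale mult e A"
    and "invertible A"
    and "complex_algebra.derivation scale mult d"
  shows "d = (\<lambda>u. 0)"
  using assms by (rule evolution_algebra.derivation_eq_zero)

end
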